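(* For every $n\ge1$, $$\frac{1}{n!}\sum_{F\in F(n)}\prod_{h\in\mathcal{H}(F)}\frac{2\,(2h-2)!!}{h\,(2h-3)!!}=\binom{2n}{n}.$$
   Context: $m!!=m(m-2)(m-4)\cdots$ (down to $1$ or $2$), with $0!!=1$ and $(-1)!!=1$. $F(n)$ is the set of labeled forests on $\{1,\dots,n\}$, i.e. sets of rooted labeled trees (children unordered) whose vertex sets partition $\{1,\dots,n\}$. For a vertex $u$ of $F$, the hook length $h_u$ is the number of descendants of $u$ (counting $u$ itself), and $\mathcal{H}(F)$ is the multiset of hook lengths of all vertices; the product is over all vertices. *)

theory Defs
  imports Complex_Main "HOL-Library.Multiset" "HOL-Library.FSet" "HOL-Library.Disjoint_Sets"
begin

text \<open>All integers \<open>m \<le> 0\<close> are sent to 1; of these only \<open>m = 0\<close> and \<open>m = -1\<close> matter.\<close>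

function dfact :: "int \<Rightarrow> int" where
  "dfact m = (if m \<le> 0 then 1 else m * dfact (m - 2))"
  by auto
termination by (relation "Wellfounded.measure nat") auto

declare dfact.simps [simp del]

text \<open>Rooted trees with unordered children, carrying a label at every vertex. In the trees of
  interest distinct vertices have distinct labels (\<open>labeled_tree\<close> below), so that a vertex is the
  same thing as its label, the children of a vertex are pairwise different, and a finite set of
  children loses nothing.\<close>

datatype (vertices: 'a) rtree = Node (root: 'a) (children: "'a rtree fset")

inductive labeled_tree :: "'a rtree \<Rightarrow> bool" where
  "\<lbrakk>\<And>c. c \<in> fset C \<Longrightarrow> labeled_tree c;
    disjoint_family_on vertices (fset C);
    r \<notin> (\<Union>c\<in>fset C. vertices c)\<rbrakk> \<Longrightarrow> labeled_tree (Node r C)"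

text \<open>The vertex sets of the trees in a forest are automatically nonempty, so being pairwise
  disjoint with union \<open>S\<close> says that they partition \<open>S\<close>.\<close>

definition labeled_forests :: "'a set \<Rightarrow> 'a rtree set set" where
  "labeled_forests S = {F. (\<forall>t\<in>F. labeled_tree t) \<and> disjoint_family_on vertices F \<and>
     (\<Union>t\<in>F. vertices t) = S}"

inductive subtree :: "'a rtree \<Rightarrow> 'a rtree \<Rightarrow> bool" where
  subtree_refl: "subtree t t"
| subtree_child: "\<lbrakk>subtree s c; c \<in> fset C\<rbrakk> \<Longrightarrow> subtree s (Node r C)"

definition descendants :: "'a rtree set \<Rightarrow> 'a \<Rightarrow> 'a set" where
  "descendants F u = {v. \<exists>t\<in>F. \<exists>s. subtree s t \<and> root s = u \<and> v \<in> vertices s}"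

definition hook_length :: "'a rtree set \<Rightarrow> 'a \<Rightarrow> nat" where
  "hook_length F u = card (descendants F u)"

definition hook_lengths :: "'a rtree set \<Rightarrow> nat multiset" where
  "hook_lengths F = image_mset (hook_length F) (mset_set (\<Union>t\<in>F. vertices t))"

end

theory Submission imports Defs begin

text \<open>Let \<open>F\<^sub>n\<close> and \<open>T\<^sub>n\<close> be the total weights of the forests and of the trees on \<open>n\<close> labels,
  each divided by \<open>n!\<close>, and let \<open>w h\<close> be the factor of a vertex of hook length \<open>h\<close>. Removing the
  root of a tree gives \<open>T\<^sub>k = w k * F\<^sub>k\<^sub>-\<^sub>1\<close>; splitting off the tree that contains a chosen label gives
  \<open>n * F\<^sub>n = (\<Sum>k=1..n. k * T\<^sub>k * F\<^sub>n\<^sub>-\<^sub>k)\<close>. Here \<open>w k = 2 * 4^(k-1) / (k * (2k-2 choose k-1))\<close>, so that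
  inductively \<open>k * T\<^sub>k = 2 * 4^(k-1)\<close>, and what remains is the identity
  \<open>n * (2n choose n) = 2 * (\<Sum>k=1..n. 4^(k-1) * (2(n-k) choose n-k))\<close>.\<close>

section \<open>Descendants and weights\<close>

lemma vertices_Node: "vertices (Node r C) = insert r (\<Union>c\<in>fset C. vertices c)"
  by simp

lemma finite_vertices: "finite (vertices t)"
  by (induction t) auto

lemma root_in_vertices: "root t \<in> vertices t"
  by (cases t) auto

lemma vertices_nonempty: "vertices t \<noteq> {}"
  using root_in_vertices by blast

lemma subtree_Node_iff: "subtree s (Node r C) \<longleftrightarrow> s = Node r C \<or> (\<exists>c\<in>fset C. subtree s c)"
  by (subst subtree.simps) auto

lemma subtree_vertices: "subtree s t \<Longrightarrow> vertices s \<subseteq> vertices t"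
  by (induction rule: subtree.induct) auto

lemma labeled_tree_Node_iff:
  "labeled_tree (Node r C) \<longleftrightarrow> (\<forall>c\<in>fset C. labeled_tree c) \<and>
     disjoint_family_on vertices (fset C) \<and> r \<notin> (\<Union>c\<in>fset C. vertices c)"
  by (subst labeled_tree.simps) auto

text \<open>Since \<open>r\<close> does not recur below the root, the whole tree is the only subtree
  rooted at \<open>r\<close>.\<close>

lemma descendants_root:
  assumes "r \<notin> (\<Union>c\<in>fset C. vertices c)"
  shows "descendants {Node r C} r = vertices (Node r C)"
proof -
  have "s = Node r C" if "subtree s (Node r C)" "root s = r" for s
    using that assms subtree_vertices root_in_vertices[of s] unfolding subtree_Node_iff by blast
  then have "subtree s (Node r C) \<and> root s = r \<longleftrightarrow> s = Node r C" for s
    by (metis rtree.sel(1) subtree_refl)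
  then show ?thesis unfolding descendants_def by (auto simp flip: conj_assoc)
qed

lemma descendants_non_root:
  assumes "u \<noteq> r"
  shows "descendants {Node r C} u = descendants (fset C) u"
proof -
  have "subtree s (Node r C) \<and> root s = u \<longleftrightarrow> (\<exists>c\<in>fset C. subtree s c \<and> root s = u)" for s
    using assms by (metis subtree_Node_iff rtree.sel(1))
  then show ?thesis unfolding descendants_def by (simp flip: conj_assoc) blast
qed

lemma disjoint_treesD:
  assumes "disjoint_family_on vertices F" "s \<in> F" "t \<in> F" "u \<in> vertices s" "u \<in> vertices t"
  shows "s = t"
  using disjoint_family_onD[OF assms(1-3)] assms(4,5) by blast

text \<open>By disjointness, every tree of \<open>F\<close> that contains \<open>u\<close> already
  lies in \<open>G\<close>. Hook lengths are thus local, which makes weights multiplicative.\<close>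

lemma descendants_subforest:
  assumes "disjoint_family_on vertices F" "G \<subseteq> F" "u \<in> (\<Union>t\<in>G. vertices t)"
  shows "descendants F u = descendants G u"
proof -
  have "t \<in> G" if "t \<in> F" "subtree s t" "root s = u" for s t
  proof -
    obtain t' where t': "t' \<in> G" "u \<in> vertices t'" using assms(3) by blast
    have "u \<in> vertices t" using that subtree_vertices root_in_vertices by blast
    then show ?thesis using disjoint_treesD[OF assms(1)] t' that(1) assms(2) by blast
  qed
  then show ?thesis using assms(2) unfolding descendants_def by blast
qed

section \<open>Weights as products over vertices\<close>

definition forest_weight :: "(nat \<Rightarrow> 'b::comm_monoid_mult) \<Rightarrow> 'a rtree set \<Rightarrow> 'b" where
  "forest_weight w F = (\<Prod>u\<in>(\<Union>t\<in>F. vertices t). w (hook_length F u))"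

lemma prod_mset_hook_lengths: "(\<Prod>h\<in>#hook_lengths F. w h) = forest_weight w F"
  by (simp add: hook_lengths_def forest_weight_def prod_unfold_prod_mset
      multiset.map_comp comp_def)

lemma forest_weight_empty: "forest_weight w {} = 1"
  by (simp add: forest_weight_def)

lemma forest_weight_insert:
  assumes "disjoint_family_on vertices (insert t F)" "t \<notin> F" "finite (\<Union>t\<in>F. vertices t)"
  shows "forest_weight w (insert t F) = forest_weight w {t} * forest_weight w F"
proof -
  have "vertices t \<inter> (\<Union>t\<in>F. vertices t) = {}"
    using assms(1) by (simp only: disjoint_family_on_insert[OF assms(2)])
  moreover have "hook_length (insert t F) u = hook_length {t} u" if "u \<in> vertices t" for u
    using that unfolding hook_length_def
    by (subst descendants_subforest[OF assms(1), of "{t}"]) auto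
  moreover have "hook_length (insert t F) u = hook_length F u"
    if "u \<in> (\<Union>t\<in>F. vertices t)" for u
    using that unfolding hook_length_def
    by (subst descendants_subforest[OF assms(1), of F]) auto
  ultimately show ?thesis
    by (simp add: forest_weight_def prod.union_disjoint finite_vertices assms(3))
qed

text \<open>The root has every vertex as a descendant, and removing it changes no other hook
  length.\<close>

lemma forest_weight_Node:
  assumes "r \<notin> (\<Union>c\<in>fset C. vertices c)"
  shows "forest_weight w {Node r C} = w (card (vertices (Node r C))) * forest_weight w (fset C)"
proof -
  have "hook_length {Node r C} u = hook_length (fset C) u" if "u \<in> (\<Union>c\<in>fset C. vertices c)" for u
    using that assms unfolding hook_length_def by (subst descendants_non_root) auto
  moreover have "hook_length {Node r C} r = card (vertices (Node r C))"
    unfolding hook_length_def descendants_root[OF assms] ..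
  moreover have "finite (\<Union>c\<in>fset C. vertices c)"
    by (simp add: finite_vertices)
  ultimately show ?thesis
    using assms by (simp add: forest_weight_def)
qed

section \<open>Decomposition of trees and forests\<close>

definition labeled_trees :: "'a set \<Rightarrow> 'a rtree set" where
  "labeled_trees S = {t. labeled_tree t \<and> vertices t = S}"

lemma labeled_forests_empty: "labeled_forests {} = {{}}"
  by (auto simp: labeled_forests_def disjoint_family_on_def vertices_nonempty)

text \<open>Vertex sets are nonempty and pairwise disjoint, so each tree is determined within
  \<open>F\<close> by its vertex set, a subset of \<open>S\<close>. Finiteness is what lets
  \<open>Abs_fset\<close> turn a forest into a set of children.\<close>

lemma finite_labeled_forest:
  assumes "F \<in> labeled_forests S" "finite S"
  shows "finite F"
proof (rule inj_on_finite)
  have "disjoint_family_on vertices F" using assms(1) by (simp add: labeled_forests_def)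
  then show "inj_on vertices F"
    using disjoint_treesD root_in_vertices by (metis inj_onI)
  show "vertices ` F \<subseteq> Pow S" using assms(1) unfolding labeled_forests_def by blast
  show "finite (Pow S)" using assms(2) by simp
qed

text \<open>Deleting the root leaves an arbitrary forest on the other labels; the inverse attaches
  the trees of that forest to \<open>r\<close> as children.\<close>

lemma bij_betw_trees:
  assumes "finite S"
  shows "bij_betw (\<lambda>(r, F). Node r (Abs_fset F))
    (SIGMA r:S. labeled_forests (S - {r})) (labeled_trees S)"
proof (rule bij_betw_byWitness[where f' = "\<lambda>t. (root t, fset (children t))"])
  have fset_Abs: "fset (Abs_fset F) = F" if "F \<in> labeled_forests (S - {r})" for r F
    using finite_labeled_forest[OF that] assms by (simp add: Abs_fset_inverse)
  show "\<forall>p\<in>(SIGMA r:S. labeled_forests (S - {r})).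
      (root (case p of (r, F) \<Rightarrow> Node r (Abs_fset F)),
       fset (children (case p of (r, F) \<Rightarrow> Node r (Abs_fset F)))) = p"
    using fset_Abs by auto
  show "\<forall>t\<in>labeled_trees S.
      (case (root t, fset (children t)) of (r, F) \<Rightarrow> Node r (Abs_fset F)) = t"
    by (simp add: fset_inverse)
  show "(\<lambda>(r, F). Node r (Abs_fset F)) ` (SIGMA r:S. labeled_forests (S - {r})) \<subseteq> labeled_trees S"
    using fset_Abs
    by (auto simp: labeled_trees_def labeled_tree_Node_iff) (auto simp: labeled_forests_def)
  show "(\<lambda>t. (root t, fset (children t))) ` labeled_trees S
      \<subseteq> (SIGMA r:S. labeled_forests (S - {r}))"
  proof
    fix p assume "p \<in> (\<lambda>t. (root t, fset (children t))) ` labeled_trees S"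
    then obtain r C where "p = (r, fset C)" "Node r C \<in> labeled_trees S"
      by (metis (no_types, lifting) imageE rtree.collapse)
    then show "p \<in> (SIGMA r:S. labeled_forests (S - {r}))"
      by (auto simp: labeled_trees_def labeled_tree_Node_iff labeled_forests_def)
  qed
qed

text \<open>Being disjoint from \<open>vertices t\<close> and covering \<open>S\<close> together
  with it means covering exactly its complement in \<open>S\<close>.\<close>

lemma insert_in_labeled_forests_iff:
  assumes "t \<notin> F"
  shows "insert t F \<in> labeled_forests S \<longleftrightarrow>
    labeled_tree t \<and> vertices t \<subseteq> S \<and> F \<in> labeled_forests (S - vertices t)"
proof -
  have "vertices t \<inter> (\<Union>s\<in>F. vertices s) = {} \<and> vertices t \<union> (\<Union>s\<in>F. vertices s) = S \<longleftrightarrow>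
      vertices t \<subseteq> S \<and> (\<Union>s\<in>F. vertices s) = S - vertices t"
    by auto
  moreover have "(\<forall>s\<in>insert t F. labeled_tree s) \<longleftrightarrow> labeled_tree t \<and> (\<forall>s\<in>F. labeled_tree s)"
    by blast
  ultimately show ?thesis
    unfolding labeled_forests_def mem_Collect_eq disjoint_family_on_insert[OF assms] UN_insert
    by argo
qed

text \<open>The tree split off is the one containing the marked label \<open>e\<close>. Every forest
  on \<open>S\<close> has exactly one such tree, so the decomposition is unique; \<open>A\<close> is
  its vertex set.\<close>

lemma bij_betw_forests:
  assumes "e \<in> S"
  shows "bij_betw (\<lambda>(A, t, F). insert t F)
    (SIGMA A:{A. A \<subseteq> S \<and> e \<in> A}. labeled_trees A \<times> labeled_forests (S - A)) (labeled_forests S)"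
    (is "bij_betw ?f ?D _")
proof (rule bij_betw_imageI)
  have D: "p \<in> ?D \<longleftrightarrow> (\<exists>t F. p = (vertices t, t, F) \<and> vertices t \<subseteq> S \<and> e \<in> vertices t \<and>
      labeled_tree t \<and> F \<in> labeled_forests (S - vertices t))" for p
    by (cases p) (auto simp: labeled_trees_def)
  \<comment> \<open>As \<open>F\<close> avoids \<open>A\<close>, the tree \<open>t\<close> is the
    only member of \<open>insert t F\<close> containing \<open>e\<close> and can be recovered from
    that set.\<close>
  have e_notin: "e \<notin> vertices s" if "e \<in> A" "F \<in> labeled_forests (S - A)" "s \<in> F" for A F s
    using that unfolding labeled_forests_def by blast
  show "inj_on ?f ?D"
  proof (rule inj_onI)
    fix p q assume "p \<in> ?D" "q \<in> ?D" and eq: "?f p = ?f q"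
    then obtain t F t' F' where
        p: "p = (vertices t, t, F)" "e \<in> vertices t" "F \<in> labeled_forests (S - vertices t)" and
        q: "q = (vertices t', t', F')" "e \<in> vertices t'" "F' \<in> labeled_forests (S - vertices t')"
      unfolding D by metis
    have ins: "insert t F = insert t' F'" using eq p(1) q(1) by simp
    then have "t = t'"
      using e_notin[OF p(2,3)] q(2) by (metis insertE insertI1)
    moreover have "t \<notin> F" "t' \<notin> F'"
      using e_notin[OF p(2,3)] p(2) e_notin[OF q(2,3)] q(2) by blast+
    ultimately have "F = F'" using ins by (simp add: insert_ident)
    then show "p = q" using \<open>t = t'\<close> p(1) q(1) by simp
  qed
  show "?f ` ?D = labeled_forests S"
  proof (intro subset_antisym subsetI)
    fix G assume "G \<in> ?f ` ?D"
    then obtain t F where G: "G = insert t F" and t: "vertices t \<subseteq> S" "e \<in> vertices t"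
        "labeled_tree t" "F \<in> labeled_forests (S - vertices t)"
      unfolding image_iff Bex_def D by auto
    then show "G \<in> labeled_forests S"
      using insert_in_labeled_forests_iff[of t F S] e_notin[OF t(2,4)] by blast
  next
    fix G assume G: "G \<in> labeled_forests S"
    then obtain t where t: "t \<in> G" "e \<in> vertices t"
      using assms unfolding labeled_forests_def by blast
    then have "insert t (G - {t}) = G" by blast
    then have "labeled_tree t" "vertices t \<subseteq> S" "G - {t} \<in> labeled_forests (S - vertices t)"
      using G insert_in_labeled_forests_iff[of t "G - {t}" S] by simp_all
    then have "(vertices t, t, G - {t}) \<in> ?D" unfolding D using t(2) by blast
    then show "G \<in> ?f ` ?D" by (rule rev_image_eqI) (use t(1) in auto)
  qed
qed

text \<open>The two bijections lead back to forests on proper subsets: one removes the root, the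
  other the set \<open>A\<close> containing \<open>e\<close>.\<close>

lemma finite_labeled_forests:
  assumes "finite S"
  shows "finite (labeled_forests S)"
  using assms
proof (induction S rule: finite_psubset_induct)
  case (psubset S)
  show ?case
  proof (cases "S = {}")
    case True
    then show ?thesis by (simp add: labeled_forests_empty)
  next
    case False
    then obtain e where e: "e \<in> S" by blast
    \<comment> \<open>Here \<open>A\<close> may be all of \<open>S\<close>; deleting the root
      \<open>r\<close> still leaves a proper subset of \<open>S\<close>.\<close>
    have "finite (labeled_trees A)" if "A \<subseteq> S" for A
    proof -
      have "finite A" using that psubset.hyps finite_subset by blast
      moreover have "finite (labeled_forests (A - {r}))" if "r \<in> A" for r
        using that \<open>A \<subseteq> S\<close> by (intro psubset.IH) blast
      ultimately show ?thesis using bij_betw_finite[OF bij_betw_trees[of A]] by blast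
    qed
    moreover have "finite (labeled_forests (S - A))" if "A \<subseteq> S" "e \<in> A" for A
      using that by (intro psubset.IH) blast
    ultimately have "finite (SIGMA A:{A. A \<subseteq> S \<and> e \<in> A}. labeled_trees A \<times> labeled_forests (S - A))"
      using psubset.hyps by (intro finite_SigmaI finite_cartesian_product) auto
    then show ?thesis using bij_betw_finite[OF bij_betw_forests[OF e]] by blast
  qed
qed

lemma finite_labeled_trees:
  assumes "finite S"
  shows "finite (labeled_trees S)"
proof -
  have "finite (SIGMA r:S. labeled_forests (S - {r}))"
    using assms by (intro finite_SigmaI finite_labeled_forests) auto
  then show ?thesis using bij_betw_finite[OF bij_betw_trees[OF assms]] by blast
qed

section \<open>Recurrences for the weight sums\<close>

lemma sum_tree_weights:
  fixes w :: "nat \<Rightarrow> 'b::comm_semiring_1"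
  assumes "finite S"
  shows "(\<Sum>t\<in>labeled_trees S. forest_weight w {t}) =
    w (card S) * (\<Sum>r\<in>S. \<Sum>F\<in>labeled_forests (S - {r}). forest_weight w F)"
proof -
  \<comment> \<open>The root has hook length \<open>card S\<close>, whatever the root and the forest
    below it.\<close>
  have weight: "forest_weight w {Node r (Abs_fset F)} = w (card S) * forest_weight w F"
    if "r \<in> S" "F \<in> labeled_forests (S - {r})" for r F
  proof -
    have "fset (Abs_fset F) = F"
      using finite_labeled_forest[OF that(2)] assms by (simp add: Abs_fset_inverse)
    moreover from this have "vertices (Node r (Abs_fset F)) = S"
      using that unfolding vertices_Node labeled_forests_def by auto
    moreover have "r \<notin> (\<Union>c\<in>F. vertices c)"
      using that unfolding labeled_forests_def by blast
    ultimately show ?thesis using forest_weight_Node[of r "Abs_fset F" w] by simp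
  qed
  have "(\<Sum>t\<in>labeled_trees S. forest_weight w {t}) =
      (\<Sum>(r, F)\<in>(SIGMA r:S. labeled_forests (S - {r})). forest_weight w {Node r (Abs_fset F)})"
    by (subst sum.reindex_bij_betw[OF bij_betw_trees[OF assms], symmetric])
      (simp add: case_prod_unfold)
  also have "\<dots> = (\<Sum>r\<in>S. \<Sum>F\<in>labeled_forests (S - {r}). forest_weight w {Node r (Abs_fset F)})"
    using assms finite_labeled_forests by (subst sum.Sigma) auto
  also have "\<dots> = (\<Sum>r\<in>S. \<Sum>F\<in>labeled_forests (S - {r}). w (card S) * forest_weight w F)"
    using weight by (intro sum.cong) auto
  finally show ?thesis by (simp add: sum_distrib_left)
qed

text \<open>For \<open>card S = n\<close> there are (n-1 choose k-1) sets \<open>A\<close> of size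
  k. Once the inner sums depend only on sizes, this is the recurrence for n times the normalized
  forest sum, before division by factorials.\<close>

lemma sum_forest_weights:
  fixes w :: "nat \<Rightarrow> 'b::comm_semiring_1"
  assumes "finite S" "e \<in> S"
  shows "(\<Sum>F\<in>labeled_forests S. forest_weight w F) =
    (\<Sum>A | A \<subseteq> S \<and> e \<in> A. (\<Sum>t\<in>labeled_trees A. forest_weight w {t}) *
       (\<Sum>F\<in>labeled_forests (S - A). forest_weight w F))"
proof -
  let ?D = "SIGMA A:{A. A \<subseteq> S \<and> e \<in> A}. labeled_trees A \<times> labeled_forests (S - A)"
  have fin: "finite A" if "A \<subseteq> S" for A using that assms(1) finite_subset by blast
  have weight: "forest_weight w (insert t F) = forest_weight w {t} * forest_weight w F"
    if "A \<subseteq> S" "e \<in> A" "t \<in> labeled_trees A" "F \<in> labeled_forests (S - A)" for A t F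
  proof (rule forest_weight_insert)
    have t: "labeled_tree t" "vertices t = A" using that(3) by (simp_all add: labeled_trees_def)
    have F: "(\<Union>s\<in>F. vertices s) = S - A" using that(4) by (simp add: labeled_forests_def)
    show notin: "t \<notin> F" using F t(2) that(2) by blast
    then have "insert t F \<in> labeled_forests S"
      unfolding insert_in_labeled_forests_iff[OF notin] using t that(1,4) by simp
    then show "disjoint_family_on vertices (insert t F)" by (simp add: labeled_forests_def)
    show "finite (\<Union>t\<in>F. vertices t)" unfolding F using assms(1) by simp
  qed
  have "(\<Sum>F\<in>labeled_forests S. forest_weight w F) =
      (\<Sum>(A, t, F)\<in>?D. forest_weight w (insert t F))"
    by (subst sum.reindex_bij_betw[OF bij_betw_forests[OF assms(2)], symmetric])
      (simp add: case_prod_unfold)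
  also have "\<dots> = (\<Sum>A | A \<subseteq> S \<and> e \<in> A. \<Sum>(t, F)\<in>labeled_trees A \<times> labeled_forests (S - A).
      forest_weight w (insert t F))"
    using assms(1) fin by (subst sum.Sigma)
      (auto intro!: finite_cartesian_product finite_labeled_trees finite_labeled_forests)
  also have "\<dots> = (\<Sum>A | A \<subseteq> S \<and> e \<in> A. \<Sum>(t, F)\<in>labeled_trees A \<times> labeled_forests (S - A).
      forest_weight w {t} * forest_weight w F)"
    using weight by (intro sum.cong) auto
  finally show ?thesis by (simp add: sum_product sum.cartesian_product)
qed

lemma sum_over_Pow_card:
  fixes g :: "nat \<Rightarrow> 'b::comm_semiring_1"
  assumes "finite S"
  shows "(\<Sum>A\<in>Pow S. g (card A)) = (\<Sum>k\<le>card S. of_nat (card S choose k) * g k)"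
proof -
  have "(\<Sum>A\<in>Pow S. g (card A)) = (\<Sum>k\<le>card S. \<Sum>A\<in>{A \<in> Pow S. card A = k}. g (card A))"
    using assms by (intro sum.group[symmetric]) (auto intro: card_mono)
  also have "\<dots> = (\<Sum>k\<le>card S. of_nat (card S choose k) * g k)"
    using n_subsets[OF assms] by (intro sum.cong) auto
  finally show ?thesis .
qed

section \<open>The hook length formula\<close>

lemma dfact_even: "dfact (2 * int k) = 2 ^ k * fact k"
proof (induction k)
  case (Suc k)
  have "dfact (2 * int (Suc k)) = 2 * int (Suc k) * dfact (2 * int k)"
    by (subst dfact.simps) simp
  then show ?case using Suc by (simp add: algebra_simps)
qed (simp add: dfact.simps)

text \<open>As \<open>2 ^ k * fact k\<close> is (2k)!!, this is (2k-1)!! (2k)!! = (2k)!, kept free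
  of division in the integers. The case \<open>k = 0\<close> uses the value 1 of
  \<open>dfact\<close> at -1.\<close>

lemma dfact_odd: "dfact (2 * int k - 1) * (2 ^ k * fact k) = fact (2 * k)"
proof (induction k)
  case (Suc k)
  have "dfact (2 * int (Suc k) - 1) = (2 * int k + 1) * dfact (2 * int k - 1)"
    by (subst dfact.simps) (simp add: algebra_simps)
  then have "dfact (2 * int (Suc k) - 1) * (2 ^ Suc k * fact (Suc k))
      = (2 * int k + 1) * (2 * int k + 2) * (dfact (2 * int k - 1) * (2 ^ k * fact k))"
    by (simp add: algebra_simps)
  also have "\<dots> = fact (2 * Suc k)" unfolding Suc by (simp add: algebra_simps)
  finally show ?case .
qed (simp add: dfact.simps)

definition hook_factor :: "nat \<Rightarrow> real" where
  "hook_factor h =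
    2 * real_of_int (dfact (2 * int h - 2)) / (real h * real_of_int (dfact (2 * int h - 3)))"

text \<open>The quotient (2k)!! / (2k-1)!! equals 4^k / (2k choose k). The central binomial
  coefficient stays on the left because the forests below a root will supply it.\<close>

lemma hook_factor_Suc:
  "hook_factor (Suc k) * real ((2 * k) choose k) = 2 * 4 ^ k / real (Suc k)"
proof -
  \<comment> \<open>For \<open>h = Suc k\<close> the argument \<open>2 * h - 3\<close> of the
    denominator becomes \<open>2 * k - 1\<close>.\<close>
  define d where "d = real_of_int (dfact (2 * int k - 1))"
  have d: "d * (2 ^ k * fact k) = fact (2 * k)"
    using arg_cong[OF dfact_odd[of k], of real_of_int] by (simp add: d_def)
  then have "d \<noteq> 0" by (metis fact_nonzero mult_zero_left)
  have "real ((2 * k) choose k) = fact (2 * k) / (fact k * fact k)"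
    by (simp add: binomial_fact)
  also have "\<dots> = d * 2 ^ k / fact k" unfolding d[symmetric] by simp
  finally have binom: "real ((2 * k) choose k) = d * 2 ^ k / fact k" .
  have "hook_factor (Suc k) = 2 * (2 ^ k * fact k) / (real (Suc k) * d)"
    using arg_cong[OF dfact_even[of k], of real_of_int] by (simp add: hook_factor_def d_def)
  then have "hook_factor (Suc k) * real ((2 * k) choose k) = 2 * (2 ^ k * 2 ^ k) / real (Suc k)"
    using \<open>d \<noteq> 0\<close> unfolding binom by simp
  then show ?thesis by (simp flip: power_mult_distrib)
qed

section \<open>Central binomial coefficients\<close>

lemma central_binomial_Suc:
  "real (Suc n) * real ((2 * Suc n) choose Suc n) = (4 * real n + 2) * real ((2 * n) choose n)"
proof -
  have "Suc n * ((2 * Suc n) choose Suc n) = 2 * Suc n * (Suc (2 * n) choose n)"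
    using Suc_times_binomial[of n "Suc (2 * n)"] by simp
  \<comment> \<open>A second absorption, after replacing \<open>Suc (2 * n) choose n\<close> by its
    mirror image \<open>Suc (2 * n) choose Suc n\<close>.\<close>
  moreover have "Suc n * (Suc (2 * n) choose n) = Suc (2 * n) * ((2 * n) choose n)"
    using Suc_times_binomial[of n "2 * n"] binomial_symmetric[of n "Suc (2 * n)"] by simp
  ultimately have "Suc n * ((2 * Suc n) choose Suc n) = 2 * (Suc (2 * n) * ((2 * n) choose n))"
    by (metis mult.assoc)
  from arg_cong[OF this, of real] show ?thesis by (simp add: algebra_simps)
qed

text \<open>Both sides are the coefficient of x^n in 2 (1-4x)^(-3/2), the derivative of the
  generating function (1-4x)^(-1/2) of the central binomial coefficients. The proof checks that both
  sides obey the same recursion.\<close>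

lemma central_binomial_convolution:
  "(\<Sum>k\<le>n. 4 ^ k * real ((2 * (n - k)) choose (n - k))) * 2
    = real (Suc n) * real ((2 * Suc n) choose Suc n)"
proof (induction n)
  case (Suc n)
  \<comment> \<open>The term \<open>k = 0\<close> is split off; the others share a factor 4.\<close>
  have "(\<Sum>k\<le>Suc n. 4 ^ k * real ((2 * (Suc n - k)) choose (Suc n - k)))
     = real ((2 * Suc n) choose Suc n)
       + 4 * (\<Sum>k\<le>n. 4 ^ k * real ((2 * (n - k)) choose (n - k)))"
    by (simp add: sum.atMost_Suc_shift sum_distrib_left mult.assoc del: sum.atMost_Suc)
  then show ?case
    using Suc central_binomial_Suc[of "Suc n"] by (simp add: algebra_simps)
qed simp

lemma sum_hook_factor_forests:
  assumes "finite S"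
  shows "(\<Sum>F\<in>labeled_forests S. forest_weight hook_factor F)
    = fact (card S) * real ((2 * card S) choose card S)"
  using assms
proof (induction S rule: finite_psubset_induct)
  case (psubset S)
  show ?case
  proof (cases "S = {}")
    case True
    then show ?thesis by (simp add: labeled_forests_empty forest_weight_empty)
  next
    case False
    then obtain e where e: "e \<in> S" by blast
    \<comment> \<open>A set \<open>A\<close> containing \<open>e\<close> will be written
      \<open>insert e B\<close>, so \<open>card B\<close> is one less than the size of the tree and
      ranges over \<open>0..n\<close>.\<close>
    define n where "n = card (S - {e})"
    have card_S: "card S = Suc n"
      using e psubset.hyps unfolding n_def by (metis card.remove)
    have card_B: "card B \<le> n" if "B \<subseteq> S - {e}" for B
      using that psubset.hyps unfolding n_def by (intro card_mono) auto
    \<comment> \<open>Every forest below the root has \<open>card B\<close> labels; the central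
      binomial coefficient of its weight sum cancels against the factor of the root.\<close>
    have trees: "(\<Sum>t\<in>labeled_trees (insert e B). forest_weight hook_factor {t})
        = 2 * 4 ^ card B * fact (card B)" if B: "B \<subseteq> S - {e}" for B
    proof -
      have fin: "finite B" using B psubset.hyps finite_subset by blast
      have card: "card (insert e B) = Suc (card B)" using B fin by (simp add: subset_Diff_insert)
      have forests: "(\<Sum>F\<in>labeled_forests (insert e B - {r}). forest_weight hook_factor F)
          = fact (card B) * real ((2 * card B) choose card B)" if r: "r \<in> insert e B" for r
      proof -
        have "insert e B - {r} \<subset> S" using r B e by blast
        moreover have "card (insert e B - {r}) = card B" using card fin r by simp
        ultimately show ?thesis using psubset.IH by simp
      qed
      have "(\<Sum>t\<in>labeled_trees (insert e B). forest_weight hook_factor {t})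
          = hook_factor (Suc (card B)) * (real (Suc (card B)) *
              (fact (card B) * real ((2 * card B) choose card B)))"
        using fin forests by (simp add: sum_tree_weights card)
      also have "\<dots> = (hook_factor (Suc (card B)) * real ((2 * card B) choose card B))
          * real (Suc (card B)) * fact (card B)"
        by simp
      finally show ?thesis unfolding hook_factor_Suc by simp
    qed
    have rest: "(\<Sum>F\<in>labeled_forests (S - insert e B). forest_weight hook_factor F)
        = fact (n - card B) * real ((2 * (n - card B)) choose (n - card B))" if B: "B \<subseteq> S - {e}" for B
    proof -
      have "card (S - insert e B) = card (S - {e} - B)" by (metis Diff_insert2)
      also have "\<dots> = n - card B"
        using B psubset.hyps finite_subset unfolding n_def by (intro card_Diff_subset) blast+
      finally show ?thesis using psubset.IH[of "S - insert e B"] e by auto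
    qed
    \<comment> \<open>The contribution of one \<open>B\<close> of size \<open>k\<close>: the trees
      on \<open>k + 1\<close> labels times the forests on the remaining
      \<open>n - k\<close>.\<close>
    define g where "g k = (2 * 4 ^ k * fact k) *
      (fact (n - k) * real ((2 * (n - k)) choose (n - k)))" for k
    have "(\<Sum>F\<in>labeled_forests S. forest_weight hook_factor F) =
        (\<Sum>A | A \<subseteq> S \<and> e \<in> A. (\<Sum>t\<in>labeled_trees A. forest_weight hook_factor {t}) *
          (\<Sum>F\<in>labeled_forests (S - A). forest_weight hook_factor F))"
      using psubset.hyps e by (rule sum_forest_weights)
    also have "\<dots> = (\<Sum>B\<in>Pow (S - {e}). g (card B))"
    proof (rule sum.reindex_bij_witness[where i = "insert e" and j = "\<lambda>A. A - {e}"])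
      fix A assume A: "A \<in> {A. A \<subseteq> S \<and> e \<in> A}"
      then have "insert e (A - {e}) = A" "A - {e} \<subseteq> S - {e}" by blast+
      then show "g (card (A - {e})) = (\<Sum>t\<in>labeled_trees A. forest_weight hook_factor {t}) *
          (\<Sum>F\<in>labeled_forests (S - A). forest_weight hook_factor F)"
        using trees[of "A - {e}"] rest[of "A - {e}"] by (simp add: g_def)
    qed (use e in auto)
    also have "\<dots> = (\<Sum>k\<le>n. real (n choose k) * g k)"
      using psubset.hyps sum_over_Pow_card[of "S - {e}" g] unfolding n_def by simp
    \<comment> \<open>The factorials in \<open>g k\<close> cancel the denominators of
      \<open>n choose k\<close>, leaving a plain convolution.\<close>
    also have "\<dots> = (\<Sum>k\<le>n. fact n * (2 * (4 ^ k * real ((2 * (n - k)) choose (n - k)))))"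
      by (intro sum.cong) (simp_all add: g_def binomial_fact)
    also have "\<dots> = fact n *
        ((\<Sum>k\<le>n. 4 ^ k * real ((2 * (n - k)) choose (n - k))) * 2)"
      by (simp add: sum_distrib_left sum_distrib_right mult_ac)
    also have "\<dots> = fact (card S) * real ((2 * card S) choose card S)"
      unfolding central_binomial_convolution card_S by (simp add: fact_Suc mult_ac)
    finally show ?thesis .
  qed
qed

theorem theorem4p5:
  fixes n :: nat
  assumes "n \<ge> 1"
  shows "1 / fact n *
      (\<Sum>F\<in>labeled_forests {1..n}. \<Prod>h\<in>#hook_lengths F.
         2 * real_of_int (dfact (2 * int h - 2)) / (real h * real_of_int (dfact (2 * int h - 3))))
    = real ((2 * n) choose n)"
  \<comment> \<open>Folding turns each product into \<open>forest_weight hook_factor F\<close>; the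
    prefactor then cancels \<open>fact (card {1..n})\<close>.\<close>
  unfolding hook_factor_def[symmetric] prod_mset_hook_lengths
  by (simp add: sum_hook_factor_forests)

end
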